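(* Let $p$ be an odd prime, let $\eta,r\in\mathbb{N}$ with $1\le\eta<r$, let $H:=\mathbb{Z}_{p^\eta}$ with the trivial linear cycle set structure and $I:=\mathbb{Z}_{p^r}$. Let $a,b\in\mathbb{Z}_{p^r}$ satisfy $a^{p^\eta}=1$, $p^\eta b=0$, $b^2=0$, and let $u$ and the parameter set $P\subseteq\mathbb{Z}_{p^r}\oplus\mathbb{Z}_{p^r}$ be attached to $(a,b)$ as in the context. For each $(\gamma,\mathfrak{f}_0)\in P$, the socle of the linear cycle set $E_{\gamma,\mathfrak{f}_0}$ is $$\operatorname{Soc}(E_{\gamma,\mathfrak{f}_0})=\bigl\{y+w_h\in E_{\gamma,\mathfrak{f}_0}:\ p^{\eta-u}\mid h\ \text{ and }\ h\mathfrak{f}_0=-by\bigr\},$$ where $0\le h<p^\eta$ and the equality $h\mathfrak{f}_0=-by$ is in $\mathbb{Z}_{p^r}$.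
   Context: $\mathbb{Z}_n$ denotes the ring of integers modulo $n$. An expression such as $0\le z<p^m$ for $z\in\mathbb{Z}_{p^r}$ means that $z$ is the class of an integer (also denoted $z$) in that range. Elements of $H=\mathbb{Z}_{p^\eta}$ are always represented by integers $0\le h<p^\eta$. A linear cycle set is an additive abelian group $L$ with a binary operation $\cdot$ such that all maps $m\mapsto l\cdot m$ are bijective, $l\cdot(m+n)=l\cdot m+l\cdot n$ and $(l+m)\cdot n=(l\cdot m)\cdot(l\cdot n)$ for all $l,m,n\in L$. It is trivial if $l\cdot m=m$ for all $l,m$. The socle of $L$ is $\operatorname{Soc}(L)=\{x\in L: x\cdot m=m\text{ for all }m\in L\}$. Data attached to $(a,b)$. If $b\neq0$, write $b=p^\beta k'$ with $0\le\beta<r$, $k'\in\mathbb{Z}_{p^r}$, $p\nmid k'$; if $b=0$, set $\beta:=r$ and $k':=1$. One has $a=1+p^{r-\eta}k$ for some $k$; if $a\neq1$, write $a-1=p^{r-\eta+u}s$ with $0\le u<\eta$ and $p\nmid s$; if $a=1$, set $u:=\eta$. The integers $q,q'\le r$ are the largest ones such that $p^q\mid ba+a-1$ and $p^{q'}\mid ba-a+1$ in $\mathbb{Z}_{p^r}$, and $k''\in\mathbb{Z}_{p^r}^{\times}$ is such that $ba+a-1=p^qk''$ (if $a=1$, one takes $k''=k'$). Parameter set $P$ (the cases below exhaust all possibilities): - if $\eta\le q$ and $q'\le\beta$: $P=\{(p^{r-q'}z_1,p^{r-\eta}z_2):0\le z_1<p^{\eta-r+q'},\ 0\le z_2<p^\eta\}$;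 - if $\eta\le q$ and $q'>\beta$: $P=\{(p^{r-q'}z_1,p^{r-q'+\beta-\eta}(k''-k')z_1+p^{r-\eta}z_2):0\le z_1<p^{\eta-r+q'},\ 0\le z_2<p^\eta\}$; - if $q<\eta$ and $q=q'=\beta$: $P=\{(p^{r-q'}z_1,p^{r-\eta}z_2):0\le z_1<p^{q'},\ 0\le z_2<p^{\beta+\eta-r}\}$; - if $q<\eta$ and $q=q'<\beta$: $P=\{(p^{r-q'}z_1,p^{r-\eta}z_2):0\le z_1<p^{q'},\ 0\le z_2<p^{u}\}$; - if $q<\eta$ and $q'=\beta<q$: $P=\{(p^{r-q'}z_1,p^{r-\eta}z_2):0\le z_1<p^{q'},\ 0\le z_2<p^{q-r+\eta}\}$; - if $q<\eta$, $q=\beta<q'$ and $q'\le r-\eta+\beta$: $P=\{(p^{r-q'}z_1,p^{r+\beta-q'-\eta}k'z_1+p^{r-\eta}z_2):0\le z_1<p^{\eta-r+q'},\ 0\le z_2<p^{q}\}$; - if $q<\eta$, $q=\beta<q'$ and $q'>r-\eta+\beta$: $P=\{(p^{\eta-\beta}z_1,k'z_1+p^{r-\eta}z_2):0\le z_1,z_2<p^{\beta}\}$. For $\gamma,\mathfrak{f}_0\in\mathbb{Z}_{p^r}$ and integers $0\le h,h'<p^\eta$, put $\alpha_\gamma(h,h')=\gamma$ if $h+h'\ge p^\eta$ and $\alpha_\gamma(h,h')=0$ if $h+h'<p^\eta$, and $$f_{\mathfrak{f}_0}(h,h')=\sum_{j=0}^{h-1}h'a^{h-j-1}\mathfrak{f}_0+\sum_{j=1}^{h-1}j\,h'\,b\,a^j\,\mathfrak{f}_0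 .$$ For $(\gamma,\mathfrak{f}_0)\in P$, $E_{\gamma,\mathfrak{f}_0}$ is the linear cycle set with underlying set $I\times H$ and operations $(y,h)+(z,l)=(y+z+\alpha_\gamma(h,l),\,h+l)$ and $(y,h)\cdot(z,l)=(a^hz+f_{\mathfrak{f}_0}(h,l)+b\,a^h\,y\,l,\;l)$. One writes $y$ for $(y,0)$ and $w_h$ for $(0,h)$, so $y+w_h=(y,h)$. *)

theory Defs
  imports "Berlekamp_Zassenhaus.Finite_Field" "HOL-Algebra.Group"
begin

text \<open>The operation of the underlying monoid record is the addition of the linear cycle set.\<close>

record 'a cycle_struct = "'a monoid" +
  cdot :: "'a \<Rightarrow> 'a \<Rightarrow> 'a" (infixl "\<cdot>\<index>" 70)

locale linear_cycle_set = comm_group L for L :: "('a, 'm) cycle_struct_scheme" (structure) +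
  assumes cdot_bij: "l \<in> carrier L \<Longrightarrow> bij_betw (\<lambda>m. l \<cdot> m) (carrier L) (carrier L)"
    and cdot_add: "\<lbrakk>l \<in> carrier L; m \<in> carrier L; n \<in> carrier L\<rbrakk>
      \<Longrightarrow> l \<cdot> (m \<otimes> n) = (l \<cdot> m) \<otimes> (l \<cdot> n)"
    and add_cdot: "\<lbrakk>l \<in> carrier L; m \<in> carrier L; n \<in> carrier L\<rbrakk>
      \<Longrightarrow> (l \<otimes> m) \<cdot> n = (l \<cdot> m) \<cdot> (l \<cdot> n)"

definition Soc :: "('a, 'm) cycle_struct_scheme \<Rightarrow> 'a set" where
  "Soc L = {x \<in> carrier L. \<forall>m \<in> carrier L. x \<cdot>\<^bsub>L\<^esub> m = m}"

text \<open>
  Throughout, the ring of integers modulo \<open>p ^ r\<close> is the type \<open>'i mod_ring\<close> with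
  \<open>CARD('i) = p ^ r\<close>, while the elements of \<open>H\<close>, the integers modulo \<open>p ^ \<eta>\<close>, are
  their representatives: natural numbers below \<open>p ^ \<eta>\<close>.
\<close>

text \<open>The largest \<open>q \<le> r\<close> such that \<open>p ^ q\<close> divides \<open>x\<close>; the value at \<open>0\<close> is \<open>r\<close>.\<close>

definition max_exp :: "nat \<Rightarrow> nat \<Rightarrow> 'i::nontriv mod_ring \<Rightarrow> nat" where
  "max_exp p r x = Max {q. q \<le> r \<and> of_nat p ^ q dvd x}"

text \<open>
  Exponents such as \<open>\<eta> - r + q'\<close> are written \<open>\<eta> + q' - r\<close>, and so on, because of truncated
  subtraction on the natural numbers; in each case where they are used they are nonnegative.
  The seven conditions are mutually exclusive and, for the data attached to \<open>(a, b)\<close>,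
  exhaustive, so that the last alternative does not occur.
\<close>

definition param_set ::
  "nat \<Rightarrow> nat \<Rightarrow> nat \<Rightarrow> nat \<Rightarrow> 'i::nontriv mod_ring \<Rightarrow> nat \<Rightarrow> nat \<Rightarrow> nat \<Rightarrow> 'i mod_ring
    \<Rightarrow> ('i mod_ring \<times> 'i mod_ring) set" where
  "param_set p \<eta> r \<beta> k' u q q' k'' =
    (if \<eta> \<le> q \<and> q' \<le> \<beta> then
       {(of_nat p ^ (r - q') * of_nat z1, of_nat p ^ (r - \<eta>) * of_nat z2) | z1 z2 :: nat.
          z1 < p ^ (\<eta> + q' - r) \<and> z2 < p ^ \<eta>}
     else if \<eta> \<le> q \<and> q' > \<beta> then
       {(of_nat p ^ (r - q') * of_nat z1,
         of_nat p ^ (r + \<beta> - q' - \<eta>) * (k'' - k') * of_nat z1 + of_nat p ^ (r - \<eta>) * of_nat z2)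
          | z1 z2 :: nat. z1 < p ^ (\<eta> + q' - r) \<and> z2 < p ^ \<eta>}
     else if q < \<eta> \<and> q = q' \<and> q' = \<beta> then
       {(of_nat p ^ (r - q') * of_nat z1, of_nat p ^ (r - \<eta>) * of_nat z2) | z1 z2 :: nat.
          z1 < p ^ q' \<and> z2 < p ^ (\<beta> + \<eta> - r)}
     else if q < \<eta> \<and> q = q' \<and> q' < \<beta> then
       {(of_nat p ^ (r - q') * of_nat z1, of_nat p ^ (r - \<eta>) * of_nat z2) | z1 z2 :: nat.
          z1 < p ^ q' \<and> z2 < p ^ u}
     else if q < \<eta> \<and> q' = \<beta> \<and> \<beta> < q then
       {(of_nat p ^ (r - q') * of_nat z1, of_nat p ^ (r - \<eta>) * of_nat z2) | z1 z2 :: nat.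
          z1 < p ^ q' \<and> z2 < p ^ (q + \<eta> - r)}
     else if q < \<eta> \<and> q = \<beta> \<and> \<beta> < q' \<and> q' \<le> r - \<eta> + \<beta> then
       {(of_nat p ^ (r - q') * of_nat z1,
         of_nat p ^ (r + \<beta> - q' - \<eta>) * k' * of_nat z1 + of_nat p ^ (r - \<eta>) * of_nat z2)
          | z1 z2 :: nat. z1 < p ^ (\<eta> + q' - r) \<and> z2 < p ^ q}
     else if q < \<eta> \<and> q = \<beta> \<and> \<beta> < q' \<and> q' > r - \<eta> + \<beta> then
       {(of_nat p ^ (\<eta> - \<beta>) * of_nat z1, k' * of_nat z1 + of_nat p ^ (r - \<eta>) * of_nat z2)
          | z1 z2 :: nat. z1 < p ^ \<beta> \<and> z2 < p ^ \<beta>}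
     else {})"

definition alpha_cocycle ::
  "nat \<Rightarrow> nat \<Rightarrow> 'i::nontriv mod_ring \<Rightarrow> nat \<Rightarrow> nat \<Rightarrow> 'i mod_ring" where
  "alpha_cocycle p \<eta> \<gamma> h h' = (if h + h' \<ge> p ^ \<eta> then \<gamma> else 0)"

definition f_cocycle ::
  "'i::nontriv mod_ring \<Rightarrow> 'i mod_ring \<Rightarrow> 'i mod_ring \<Rightarrow> nat \<Rightarrow> nat \<Rightarrow> 'i mod_ring" where
  "f_cocycle a b f0 h h' =
     (\<Sum>j = 0..<h. of_nat h' * a ^ (h - j - 1) * f0)
     + (\<Sum>j = 1..<h. of_nat j * of_nat h' * b * a ^ j * f0)"

text \<open>The pair \<open>(y, h)\<close> is the element \<open>y + w\<^sub>h\<close>.\<close>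

definition E_lcs ::
  "nat \<Rightarrow> nat \<Rightarrow> 'i::nontriv mod_ring \<Rightarrow> 'i mod_ring \<Rightarrow> 'i mod_ring \<Rightarrow> 'i mod_ring
    \<Rightarrow> ('i mod_ring \<times> nat) cycle_struct" where
  "E_lcs p \<eta> a b \<gamma> f0 =
     \<lparr>carrier = UNIV \<times> {..<p ^ \<eta>},
      monoid.mult = (\<lambda>(y, h) (z, l). (y + z + alpha_cocycle p \<eta> \<gamma> h l, (h + l) mod p ^ \<eta>)),
      one = (0, 0),
      cdot = (\<lambda>(y, h) (z, l). (a ^ h * z + f_cocycle a b f0 h l + b * a ^ h * y * of_nat l, l))\<rparr>"

end

theory Submission
  imports Defs
begin

text \<open>
  An element \<open>(y, h)\<close> lies in the socle iff \<open>a ^ h = 1\<close> and \<open>f(h, 1) + b y = 0\<close>. Put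
  \<open>c = r - \<eta> + u\<close>, so that \<open>a \<equiv> 1\<close> modulo \<open>p ^ c\<close> with \<open>c \<ge> 1\<close>. If \<open>p ^ d\<close> divides \<open>h\<close>, then
  \<open>1 + a + \<dots> + a ^ (h - 1) \<equiv> h\<close> modulo \<open>p ^ (c + d)\<close>; hence \<open>a ^ h = 1\<close> iff \<open>p ^ (\<eta> - u)\<close>
  divides \<open>h\<close>, and in that case \<open>f(h, 1) = h f0 + b f0 T\<close>, where \<open>T\<close> is the sum of the \<open>j a ^ j\<close>
  for \<open>j < h\<close> and is divisible by every power of \<open>p\<close> that divides \<open>h\<close>. Since \<open>b ^ 2 = 0\<close>,
  multiplying either \<open>f(h, 1) + b y = 0\<close> or \<open>h f0 + b y = 0\<close> by \<open>b\<close> gives \<open>h b f0 = 0\<close>, hence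
  \<open>b f0 T = 0\<close>, and the two equations agree.
\<close>

section \<open>Power sums over blocks of indices, and their divisibility by powers of
  \<open>p\<close>\<close>

text \<open>Cutting the range into \<open>k\<close> blocks of length \<open>m\<close> factors the
  sum. The case \<open>k = p\<close> drives the later inductions on the exponent of
  \<open>p\<close>.\<close>

lemma sum_power_lessThan_mult:
  fixes a :: "'a::comm_ring_1"
  shows "(\<Sum>j<k * m. a ^ j) = (\<Sum>j<m. a ^ j) * (\<Sum>i<k. (a ^ m) ^ i)"
proof (induction k)
  case (Suc k)
  have "{..<Suc k * m} = {..<k * m} \<union> {k * m..<k * m + m}" by auto
  then have "(\<Sum>j<Suc k * m. a ^ j) = (\<Sum>j<k * m. a ^ j) + (\<Sum>j=k * m..<k * m + m. a ^ j)"
    by (simp add: sum.union_disjoint ivl_disj_int)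
  also have "(\<Sum>j=k * m..<k * m + m. a ^ j) = (\<Sum>j<m. a ^ (j + k * m))"
    using sum.shift_bounds_nat_ivl[of "\<lambda>j. a ^ j" 0 "k * m" m]
    by (simp add: atLeast0LessThan add.commute)
  also have "\<dots> = (\<Sum>j<m. a ^ j) * (a ^ m) ^ k"
    by (simp add: power_add sum_distrib_right power_mult[symmetric] mult.commute)
  finally show ?case using Suc by (simp add: algebra_simps)
qed simp

text \<open>In block \<open>i\<close> the weight is \<open>j + i * m\<close>; the two summands come
  from \<open>j\<close> and from \<open>i * m\<close>.\<close>

lemma sum_of_nat_power_lessThan_mult:
  fixes a :: "'a::comm_ring_1"
  shows "(\<Sum>j<k * m. of_nat j * a ^ j) =
    (\<Sum>j<m. of_nat j * a ^ j) * (\<Sum>i<k. (a ^ m) ^ i)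
    + of_nat m * (\<Sum>j<m. a ^ j) * (\<Sum>i<k. of_nat i * (a ^ m) ^ i)"
proof (induction k)
  case (Suc k)
  have "{..<Suc k * m} = {..<k * m} \<union> {k * m..<k * m + m}" by auto
  then have "(\<Sum>j<Suc k * m. of_nat j * a ^ j) =
      (\<Sum>j<k * m. of_nat j * a ^ j) + (\<Sum>j=k * m..<k * m + m. of_nat j * a ^ j)"
    by (simp add: sum.union_disjoint ivl_disj_int)
  also have "(\<Sum>j=k * m..<k * m + m. of_nat j * a ^ j) =
      (\<Sum>j<m. of_nat (j + k * m) * a ^ (j + k * m))"
    using sum.shift_bounds_nat_ivl[of "\<lambda>j. of_nat j * a ^ j" 0 "k * m" m]
    by (simp add: atLeast0LessThan add.commute)
  also have "\<dots> = (\<Sum>j<m. of_nat j * a ^ j * (a ^ m) ^ k + of_nat m * of_nat k * a ^ j * (a ^ m) ^ k)"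
    by (intro sum.cong) (auto simp: power_add power_mult[symmetric] algebra_simps)
  also have "\<dots> = (\<Sum>j<m. of_nat j * a ^ j) * (a ^ m) ^ k
      + of_nat m * (\<Sum>j<m. a ^ j) * (of_nat k * (a ^ m) ^ k)"
    by (simp add: sum.distrib sum_distrib_left sum_distrib_right algebra_simps)
  finally show ?case using Suc by (simp add: algebra_simps)
qed simp

lemma dvd_power_minus_one:
  fixes a :: "'a::comm_ring_1"
  assumes "x dvd a - 1"
  shows "x dvd a ^ n - 1"
  unfolding power_diff_1_eq using assms by (rule dvd_mult2)

lemma dvd_sum_power_minus:
  fixes a :: "'a::comm_ring_1"
  assumes "x dvd a - 1"
  shows "x dvd (\<Sum>j<n. a ^ j) - of_nat n"
proof -
  have "(\<Sum>j<n. a ^ j) - of_nat n = (\<Sum>j<n. a ^ j - 1)" by (simp add: sum_subtractf)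
  then show ?thesis using assms by (auto intro: dvd_sum dvd_power_minus_one)
qed

text \<open>The sum is \<open>p * (p - 1) / 2\<close>, and \<open>(p - 1) / 2\<close> is an integer.
  Oddness enters the later divisibilities through this fact.\<close>

lemma dvd_sum_of_nat_odd:
  assumes "odd p"
  shows "(of_nat p :: 'a::comm_ring_1) dvd (\<Sum>i<p. of_nat i)"
proof -
  have "2 * (\<Sum>i<p. i) = p * (p - 1)"
  proof (induction p)
    case (Suc p)
    then show ?case by (cases p) auto
  qed simp
  moreover obtain k where k: "p = 2 * k + 1" using assms by (rule oddE)
  then have "p - 1 = 2 * k" by simp
  ultimately have "(\<Sum>i<p. i) = p * k" by simp
  then have "(\<Sum>i<p. of_nat i) = (of_nat (p * k) :: 'a)" by (simp only: flip: of_nat_sum)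
  then show ?thesis by simp
qed

lemma dvd_sum_of_nat_power_odd:
  fixes a :: "'a::comm_ring_1"
  assumes "odd p" and "of_nat p dvd a - 1"
  shows "of_nat p dvd (\<Sum>i<p. of_nat i * a ^ i)"
proof -
  have "(\<Sum>i<p. of_nat i * a ^ i) = (\<Sum>i<p. of_nat i * (a ^ i - 1)) + (\<Sum>i<p. of_nat i)"
    by (simp add: sum.distrib[symmetric] algebra_simps)
  then show ?thesis
    using assms by (auto intro!: dvd_add dvd_sum dvd_mult dvd_power_minus_one dvd_sum_of_nat_odd)
qed

text \<open>Gains a factor \<open>p\<close> over \<open>dvd_sum_power_minus\<close>: once
  \<open>a - 1\<close> is pulled out, the inner sums are congruent to \<open>i\<close> modulo
  \<open>p\<close>, and the sum of all \<open>i < p\<close> is a multiple of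
  \<open>p\<close>.\<close>

lemma dvd_sum_power_odd:
  fixes a :: "'a::comm_ring_1"
  assumes "odd p" and p: "of_nat p dvd a - 1" and x: "x dvd a - 1"
  shows "x * of_nat p dvd (\<Sum>i<p. a ^ i) - of_nat p"
proof -
  have "(\<Sum>i<p. a ^ i) - of_nat p = (\<Sum>i<p. a ^ i - 1)" by (simp add: sum_subtractf)
  also have "\<dots> = (a - 1) * (\<Sum>i<p. \<Sum>j<i. a ^ j)"
    by (simp add: power_diff_1_eq sum_distrib_left)
  also have "(\<Sum>i<p. \<Sum>j<i. a ^ j) =
      (\<Sum>i<p. (\<Sum>j<i. a ^ j) - of_nat i) + (\<Sum>i<p. of_nat i)"
    by (simp add: sum_subtractf)
  finally show ?thesis
    using assms
    by (auto intro!: mult_dvd_mono dvd_add dvd_sum dvd_sum_power_minus dvd_sum_of_nat_odd)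
qed

context
  fixes a :: "'a::comm_ring_1" and p c :: nat
  assumes odd: "odd p" and c: "1 \<le> c" and a: "of_nat p ^ c dvd a - 1"
begin

lemma base_dvd_minus_one: "of_nat p dvd a - 1"
  using dvd_power[of c "of_nat p"] a c by (auto intro: dvd_trans)

text \<open>Each passage from \<open>m\<close> to \<open>p * m\<close> gains one factor
  \<open>p\<close>, by \<open>dvd_sum_power_odd\<close> applied to \<open>a ^ m\<close>.\<close>

lemma prime_power_dvd_sum_power_minus:
  assumes "p ^ d dvd h"
  shows "of_nat p ^ (c + d) dvd (\<Sum>j<h. a ^ j) - of_nat h"
  using assms
proof (induction d arbitrary: h)
  case 0
  then show ?case using a by (simp add: dvd_sum_power_minus)
next
  case (Suc d)
  then obtain m0 where "h = p ^ Suc d * m0" by (auto simp: dvd_def)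
  then obtain m where h: "h = p * m" and m: "p ^ d dvd m" by (metis dvd_triv_left mult.assoc power_Suc)
  define S where "S = (\<Sum>j<m. a ^ j)"
  define R where "R = (\<Sum>i<p. (a ^ m) ^ i)"
  have IH: "of_nat p ^ (c + d) dvd S - of_nat m" unfolding S_def using Suc.IH[OF m] .
  have m': "(of_nat p :: 'a) ^ d dvd of_nat m"
    using m by (metis of_nat_power dvd_def of_nat_mult)
  have "(of_nat p :: 'a) ^ d dvd S"
    using IH m' by (metis diff_add_cancel dvd_add dvd_trans le_add2 le_imp_power_dvd)
  \<comment> \<open>In \<open>a ^ m - 1 = (a - 1) * S\<close> the first factor contributes
    \<open>p ^ c\<close> and the second \<open>p ^ d\<close>.\<close>
  then have am: "of_nat p ^ (c + d) dvd a ^ m - 1"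
    unfolding power_diff_1_eq S_def[symmetric] power_add using a by (rule mult_dvd_mono[rotated])
  have "of_nat p ^ (c + d) * of_nat p dvd R - of_nat p"
    unfolding R_def using odd dvd_power_minus_one[OF base_dvd_minus_one] am
    by (rule dvd_sum_power_odd)
  moreover have "of_nat p ^ (c + d) * of_nat p dvd (S - of_nat m) * of_nat p"
    using IH by (rule mult_dvd_mono) simp
  moreover have "(\<Sum>j<h. a ^ j) - of_nat h = S * (R - of_nat p) + (S - of_nat m) * of_nat p"
    unfolding h sum_power_lessThan_mult S_def R_def by (simp add: algebra_simps)
  ultimately show ?case by (auto simp: mult.commute intro: dvd_add dvd_mult)
qed

text \<open>In the block formula the first product gets \<open>p ^ d\<close> by induction and
  \<open>p\<close> from a geometric sum of \<open>p\<close> terms; the second gets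
  \<open>p ^ d\<close> from \<open>m\<close> and \<open>p\<close> from the weighted sum.\<close>

lemma prime_power_dvd_sum_of_nat_power:
  assumes "p ^ d dvd h"
  shows "of_nat p ^ d dvd (\<Sum>j<h. of_nat j * a ^ j)"
  using assms
proof (induction d arbitrary: h)
  case (Suc d)
  then obtain m0 where "h = p ^ Suc d * m0" by (auto simp: dvd_def)
  then obtain m where h: "h = p * m" and m: "p ^ d dvd m" by (metis dvd_triv_left mult.assoc power_Suc)
  have am: "of_nat p dvd a ^ m - 1" by (intro dvd_power_minus_one base_dvd_minus_one)
  have "of_nat p dvd (\<Sum>i<p. (a ^ m) ^ i)"
    using dvd_sum_power_minus[OF am, of p] by (metis diff_add_cancel dvd_add dvd_refl)
  moreover have "(of_nat p :: 'a) ^ d dvd of_nat m"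
    using m by (metis of_nat_power dvd_def of_nat_mult)
  moreover note Suc.IH[OF m] dvd_sum_of_nat_power_odd[OF odd am]
  ultimately show ?case
    unfolding h sum_of_nat_power_lessThan_mult power_Suc2
    by (intro dvd_add mult_dvd_mono) (auto intro: dvd_mult2)
qed simp

end

section \<open>Units of the integers modulo \<open>p ^ r\<close>\<close>

lemma of_nat_mod_ring_dvd_one:
  assumes "coprime n CARD('i)"
  shows "(of_nat n :: 'i::nontriv mod_ring) dvd 1"
proof -
  obtain x where "[int n * x = 1] (mod int CARD('i))"
    using assms by (metis cong_solve_coprime_int coprime_int_iff)
  then have "of_int_mod_ring (int n * x) = (of_int_mod_ring 1 :: 'i mod_ring)"
    by (transfer) (simp add: cong_def)
  then have "of_nat n * of_int x = (1 :: 'i mod_ring)"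
    by (metis of_int_of_int_mod_ring of_int_mult of_int_of_nat_eq of_int_1)
  then show ?thesis by (metis dvd_triv_left)
qed

lemma of_nat_mod_ring_dvd_one_prime_power:
  assumes "prime p" and "CARD('i) = p ^ r" and "\<not> p dvd n"
  shows "(of_nat n :: 'i::nontriv mod_ring) dvd 1"
  using assms by (metis coprime_commute coprime_power_right_iff of_nat_mod_ring_dvd_one prime_imp_coprime)

text \<open>As \<open>p\<close> is nilpotent, it divides no unit; conversely, a representative prime
  to \<open>p\<close> is invertible.\<close>

lemma dvd_one_mod_ring_iff:
  fixes x :: "'i::nontriv mod_ring"
  assumes p: "prime p" and card: "CARD('i) = p ^ r"
  shows "x dvd 1 \<longleftrightarrow> \<not> of_nat p dvd x"
proof
  assume "x dvd 1"
  show "\<not> of_nat p dvd x"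
  proof
    assume "of_nat p dvd x"
    then have "of_nat p ^ r dvd (1 :: 'i mod_ring)"
      using \<open>x dvd 1\<close> by (metis dvd_power_same dvd_trans power_one)
    moreover have "(of_nat p :: 'i mod_ring) ^ r = 0"
      by (metis card of_nat_card_eq_0 of_nat_power)
    ultimately show False by simp
  qed
next
  assume nd: "\<not> of_nat p dvd x"
  define n where "n = nat (to_int_mod_ring x)"
  have x: "x = of_nat n"
    unfolding n_def by (metis of_int_of_int_mod_ring of_int_mod_ring_to_int_mod_ring
      of_nat_nat range_to_int_mod_ring atLeastLessThan_iff rangeI)
  then have "\<not> p dvd n" using nd by (metis dvd_def of_nat_mult)
  then show "x dvd 1" unfolding x using p card by (intro of_nat_mod_ring_dvd_one_prime_power)
qed

section \<open>Membership in the socle as two equations\<close>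

text \<open>Reverses the first sum and adds the zero term \<open>j = 0\<close> to the second;
  linearity in \<open>l\<close> becomes visible.\<close>

lemma f_cocycle_alt:
  "f_cocycle a b f0 h l =
    of_nat l * ((\<Sum>j<h. a ^ j) * f0 + b * f0 * (\<Sum>j<h. of_nat j * a ^ j))"
proof -
  have "(\<Sum>j = 0..<h. of_nat l * a ^ (h - j - 1) * f0) = (\<Sum>j<h. of_nat l * a ^ j * f0)"
    using sum.nat_diff_reindex[of "\<lambda>j. of_nat l * a ^ j * f0" h] by (simp add: atLeast0LessThan)
  moreover have "(\<Sum>j = 1..<h. of_nat j * of_nat l * b * a ^ j * f0) =
      (\<Sum>j<h. of_nat j * of_nat l * b * a ^ j * f0)"
    by (rule sum.mono_neutral_left) (auto simp: not_le)
  ultimately show ?thesis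
    unfolding f_cocycle_def
    by (simp add: sum_distrib_left sum_distrib_right algebra_simps)
qed

lemma mem_Soc_E_lcs_iff:
  assumes "1 < p ^ \<eta>"
  shows "(y, h) \<in> Soc (E_lcs p \<eta> a b \<gamma> f0) \<longleftrightarrow>
    h < p ^ \<eta> \<and> a ^ h = 1 \<and>
    (\<Sum>j<h. a ^ j) * f0 + b * f0 * (\<Sum>j<h. of_nat j * a ^ j) + b * y = 0"
    (is "_ \<longleftrightarrow> _ \<and> _ \<and> ?g + b * y = 0")
proof -
  have "(y, h) \<in> Soc (E_lcs p \<eta> a b \<gamma> f0) \<longleftrightarrow>
    h < p ^ \<eta> \<and> (\<forall>z. \<forall>l<p ^ \<eta>. a ^ h * z + of_nat l * ?g + b * a ^ h * y * of_nat l = z)"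
    by (auto simp: Soc_def E_lcs_def f_cocycle_alt)
  moreover have "(\<forall>z. \<forall>l<p ^ \<eta>. a ^ h * z + of_nat l * ?g + b * a ^ h * y * of_nat l = z) \<longleftrightarrow>
    a ^ h = 1 \<and> ?g + b * y = 0" (is "?L \<longleftrightarrow> ?R")
  proof
    assume L: ?L
    have "0 < p ^ \<eta>" using assms by linarith
    \<comment> \<open>Test element \<open>(1, 0)\<close>; the next test, \<open>(1, 1)\<close>, is
      in the carrier because \<open>1 < p ^ \<eta>\<close>.\<close>
    then have ah: "a ^ h = 1" using L[rule_format, of 0 1] by simp
    have "1 + of_nat 1 * ?g + b * 1 * y * of_nat 1 = 1"
      using L[rule_format, OF assms, of 1] unfolding ah mult_1 .
    then show ?R using ah by (simp add: add.assoc)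
  next
    assume R: ?R
    have "of_nat l * ?g + b * y * of_nat l = of_nat l * (?g + b * y)" for l
      by (simp only: distrib_left mult_ac)
    with R have "of_nat l * ?g + b * y * of_nat l = 0" for l by simp
    then show ?L using R by (simp add: add.assoc)
  qed
  ultimately show ?thesis by blast
qed

section \<open>The multiplicative order of \<open>a\<close>, and the comparison of the two
  equations\<close>

text \<open>With \<open>d\<close> the multiplicity of \<open>p\<close> in \<open>h\<close>,
  \<open>a ^ h - 1\<close> is \<open>p ^ (c + d)\<close> times a unit \<open>w\<close>, so it
  vanishes iff \<open>r \<le> c + d\<close>.\<close>

lemma power_eq_one_mod_ring_iff:
  fixes a s :: "'i::nontriv mod_ring"
  assumes p: "prime p" "odd p" and card: "CARD('i) = p ^ r" and c: "1 \<le> c"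
    and a: "a = 1 + of_nat p ^ c * s" and s: "\<not> of_nat p dvd s"
  shows "a ^ h = 1 \<longleftrightarrow> p ^ (r - c) dvd h"
proof (cases "h = 0")
  case False
  define d where "d = multiplicity p h"
  obtain h' where h: "h = p ^ d * h'" and h': "\<not> p dvd h'"
    using False p by (metis d_def multiplicity_decompose' not_prime_unit)
  have "of_nat p ^ (c + d) dvd (\<Sum>j<h. a ^ j) - of_nat h"
    using p c h a by (intro prime_power_dvd_sum_power_minus) auto
  then obtain z where z: "(\<Sum>j<h. a ^ j) = of_nat h + of_nat p ^ (c + d) * z"
    by (metis dvdE diff_add_cancel add.commute)
  define w where "w = s * (of_nat h' + of_nat p ^ c * z)"
  have aw: "a ^ h - 1 = of_nat p ^ (c + d) * w"
    unfolding power_diff_1_eq z unfolding a w_def h by (simp add: power_add algebra_simps)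
  have "w dvd 1"
  proof -
    have "(of_nat h' :: 'i mod_ring) dvd 1"
      using p(1) card h' by (rule of_nat_mod_ring_dvd_one_prime_power)
    then have "\<not> of_nat p dvd (of_nat h' :: 'i mod_ring)"
      using dvd_one_mod_ring_iff[OF p(1) card] by blast
    \<comment> \<open>Since \<open>c \<ge> 1\<close>, the correction term cannot spoil the
      invertibility of \<open>h'\<close>.\<close>
    moreover have "(of_nat p :: 'i mod_ring) dvd of_nat p ^ c * z"
      using c by (intro dvd_mult2 dvd_power) auto
    ultimately have "\<not> of_nat p dvd of_nat h' + of_nat p ^ c * z"
      by (simp add: dvd_add_left_iff)
    then show ?thesis
      unfolding w_def using s dvd_one_mod_ring_iff[OF p(1) card] by (metis mult_dvd_mono mult_1)
  qed
  then obtain v where v: "1 = w * v" by (rule dvdE)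
  have "a ^ h = 1 \<longleftrightarrow> (of_nat (p ^ (c + d)) :: 'i mod_ring) = 0"
  proof
    assume "a ^ h = 1"
    with aw have "of_nat p ^ (c + d) * w * v = 0" by simp
    then show "(of_nat (p ^ (c + d)) :: 'i mod_ring) = 0" unfolding mult.assoc v[symmetric] by simp
  next
    assume "(of_nat (p ^ (c + d)) :: 'i mod_ring) = 0"
    with aw show "a ^ h = 1" by simp
  qed
  also have "\<dots> \<longleftrightarrow> r \<le> c + d"
    unfolding of_nat_eq_0_iff_char_dvd semiring_char_mod_ring card using p
    by (metis dvd_power_iff_le prime_ge_2_nat)
  also have "\<dots> \<longleftrightarrow> p ^ (r - c) dvd h"
    using False p unfolding d_def
    by (subst power_dvd_iff_le_multiplicity) auto
  finally show ?thesis .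
qed simp

theorem proposition2p24:
  fixes p \<eta> r \<beta> u q q' :: nat
    and a b k' k'' \<gamma> f0 :: "'i::nontriv mod_ring"
  assumes "prime p" and "odd p" and "1 \<le> \<eta>" and "\<eta> < r"
    and "CARD('i) = p ^ r"
    and "a ^ (p ^ \<eta>) = 1" and "of_nat (p ^ \<eta>) * b = 0" and "b ^ 2 = 0"
    and "b \<noteq> 0 \<Longrightarrow> \<beta> < r \<and> b = of_nat p ^ \<beta> * k' \<and> \<not> of_nat p dvd k'"
    and "b = 0 \<Longrightarrow> \<beta> = r \<and> k' = 1"
    and "a \<noteq> 1 \<Longrightarrow> u < \<eta> \<and> (\<exists>s. a - 1 = of_nat p ^ (r - \<eta> + u) * s \<and> \<not> of_nat p dvd s)"
    and "a = 1 \<Longrightarrow> u = \<eta>"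
    and "q = max_exp p r (b * a + a - 1)"
    and "q' = max_exp p r (b * a - a + 1)"
    and "k'' dvd 1" and "b * a + a - 1 = of_nat p ^ q * k''"
    and "a = 1 \<Longrightarrow> k'' = k'"
    and "(\<gamma>, f0) \<in> param_set p \<eta> r \<beta> k' u q q' k''"
  shows "Soc (E_lcs p \<eta> a b \<gamma> f0) =
    {(y, h). (y, h) \<in> carrier (E_lcs p \<eta> a b \<gamma> f0) \<and>
             p ^ (\<eta> - u) dvd h \<and> of_nat h * f0 = - b * y}"
proof -
  \<comment> \<open>For \<open>a = 1\<close> this gives \<open>c = r\<close>, in line with
    \<open>a - 1 = 0\<close>.\<close>
  define c where "c = r - \<eta> + u"
  have u: "u \<le> \<eta>" using assms(11,12) by (cases "a = 1") (simp, metis less_imp_le)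
  have c: "1 \<le> c" "r - c = \<eta> - u" using u assms(4) by (auto simp: c_def)
  have a: "of_nat p ^ c dvd a - 1" using assms(11) by (cases "a = 1") (auto simp: c_def)
  have order: "a ^ h = 1 \<longleftrightarrow> p ^ (\<eta> - u) dvd h" for h
  proof (cases "a = 1")
    case True
    then show ?thesis using assms(12) by simp
  next
    case False
    then obtain s where "a - 1 = of_nat p ^ c * s" and s: "\<not> of_nat p dvd s"
      using assms(11) by (auto simp: c_def)
    then have "a = 1 + of_nat p ^ c * s" by (simp add: algebra_simps)
    from power_eq_one_mod_ring_iff[OF assms(1,2,5) c(1) this s] show ?thesis
      unfolding c(2) .
  qed
  have equiv: "(\<Sum>j<h. a ^ j) * f0 + b * f0 * (\<Sum>j<h. of_nat j * a ^ j) + b * y = 0 \<longleftrightarrow>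
      of_nat h * f0 = - b * y" (is "?S * f0 + b * f0 * ?T + b * y = 0 \<longleftrightarrow> _")
    if h: "p ^ (\<eta> - u) dvd h" for h y
  proof -
    have "of_nat p ^ (c + (\<eta> - u)) dvd ?S - of_nat h"
      using assms(2) c(1) a h by (rule prime_power_dvd_sum_power_minus)
    moreover have "c + (\<eta> - u) = r" using u assms(4) by (simp add: c_def)
    moreover have "(of_nat p :: 'i mod_ring) ^ r = 0"
      by (metis assms(5) of_nat_card_eq_0 of_nat_power)
    \<comment> \<open>The congruence is modulo \<open>p ^ r\<close>, which is zero here, so it is an
      equality.\<close>
    ultimately have S: "?S = of_nat h" by simp
    \<comment> \<open>Up to a unit \<open>h\<close> is \<open>p ^ d\<close>, so \<open>p ^ d\<close>
      annihilates \<open>b * f0\<close>, while it divides \<open>?T\<close>.\<close>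
    have T: "b * f0 * ?T = 0" if hb: "of_nat h * (b * f0) = 0"
    proof (cases "h = 0")
      case False
      define d where "d = multiplicity p h"
      obtain h' where hd: "h = p ^ d * h'" and h': "\<not> p dvd h'"
        using False assms(1) by (metis d_def multiplicity_decompose' not_prime_unit)
      have "(of_nat h' :: 'i mod_ring) dvd 1"
        using assms(1,5) h' by (rule of_nat_mod_ring_dvd_one_prime_power)
      then obtain v where "1 = of_nat h' * (v :: 'i mod_ring)" by (rule dvdE)
      then have "of_nat p ^ d * (b * f0) = of_nat p ^ d * (b * f0) * (of_nat h' * v)" by simp
      also have "\<dots> = of_nat h * (b * f0) * v" unfolding hd by (simp add: mult_ac)
      finally have "of_nat p ^ d * (b * f0) = 0" using hb by simp
      moreover have "of_nat p ^ d dvd ?T"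
        using assms(2) c(1) a by (rule prime_power_dvd_sum_of_nat_power) (simp add: hd)
      then obtain t where "?T = of_nat p ^ d * t" by (rule dvdE)
      then have "b * f0 * ?T = of_nat p ^ d * (b * f0) * t" by (simp only: mult_ac)
      ultimately show ?thesis by simp
    qed simp
    have bb: "b * (b * x) = 0" for x using assms(8) by (simp add: power2_eq_square mult.assoc[symmetric])
    show ?thesis
    proof
      assume eq: "?S * f0 + b * f0 * ?T + b * y = 0"
      \<comment> \<open>Multiplying by \<open>b\<close> kills the last two terms and leaves the
        hypothesis of \<open>T\<close>.\<close>
      then have "b * (of_nat h * f0 + b * f0 * ?T + b * y) = 0" unfolding S by simp
      then have "of_nat h * (b * f0) = 0" by (simp add: algebra_simps bb)
      then show "of_nat h * f0 = - b * y" using eq T S by (simp add: eq_neg_iff_add_eq_0)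
    next
      assume eq: "of_nat h * f0 = - b * y"
      have "of_nat h * (b * f0) = b * (of_nat h * f0)" by (simp add: algebra_simps)
      also have "\<dots> = 0" unfolding eq by (simp add: bb)
      finally show "?S * f0 + b * f0 * ?T + b * y = 0" using eq T S by simp
    qed
  qed
  have "1 < p ^ \<eta>" using assms(1,3) by (intro one_less_power prime_gt_1_nat) auto
  note mem = mem_Soc_E_lcs_iff[OF this]
  have carrier: "(y, h) \<in> carrier (E_lcs p \<eta> a b \<gamma> f0) \<longleftrightarrow> h < p ^ \<eta>" for y h
    by (simp add: E_lcs_def)
  show ?thesis by (auto simp: mem carrier order equiv)
qed

end
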